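(* Let $s,s'$ be nonnegative integers with $s'<s$, and let $G$ be a weakly modular graph that is $(s,s')$-dismantlable. Then $G$ is $184s$-hyperbolic.
   Context: All graphs are undirected, connected, without loops or multiple edges, possibly infinite; $d$ is the shortest-path distance. $B_r(v,G)=\{x: d_G(v,x)\le r\}$; for a vertex $u$, $B_r(v,G-\{u\})$ is the ball of radius $r$ around $v$ in the graph obtained from $G$ by deleting $u$. Given a well-order $\preceq$ on $V$, $X_v=\{w: w\preceq v\}$. $G$ is $(s,s')$-dismantlable if $V$ admits a well-order $\preceq$ such that for each vertex $v$ (other than the least element) there is a vertex $u\ne v$, $u\preceq v$, with $B_s(v,G-\{u\})\cap X_v\subseteq B_{s'}(u,G)$. $G$ is weakly modular if (triangle condition) for any $u,v,w$ with $1=d(v,w)<d(u,v)=d(u,w)$ there is a common neighbor $x$ of $v,w$ with $d(u,x)=d(u,v)-1$, and (quadrangle condition) for any $u,v,w,z$ with $d(v,z)=d(w,z)=1$ and $2=d(v,w)\le d(u,v)=d(u,w)=d(u,z)-1$ there is a common neighbor $x$ of $v,w$ with $d(u,x)=d(u,v)-1$. A graph is $\delta$-hyperbolic if for any four vertices $u,v,x,y$ the two largest of $d(u,v)+d(x,y)$, $d(u,x)+d(v,y)$, $d(u,y)+d(v,x)$ differ by at most $2\delta$. *)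

theory Defs
  imports
    "Graph_Theory.Digraph_Component"
    "Graph_Theory.Shortest_Path"
begin

text \<open>
  An undirected edge is represented by a pair of opposite arcs, as usual in
  \<^theory>\<open>Graph_Theory.Digraph\<close>. The library's locale \<^locale>\<open>graph\<close> is not used
  because it requires finiteness.
\<close>

locale connected_simple_graph = sym_digraph + loopfree_digraph + nomulti_digraph +
  assumes connected_G: "Digraph_Component.connected G"

text \<open>
  The value is infinite if the two vertices are not joined by a walk, which matters below
  because deleting a vertex may disconnect the graph.
\<close>

definition gdist :: "('a, 'b) pre_digraph \<Rightarrow> 'a \<Rightarrow> 'a \<Rightarrow> ereal" where
  "gdist G u v = wf_digraph.\<mu> G (\<lambda>_. 1) u v"

lemma gdist_le_iff:
  assumes "wf_digraph G"
  shows "gdist G u v \<le> ereal (real n) \<longleftrightarrow> (\<exists>p. pre_digraph.awalk G u p v \<and> length p \<le> n)"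
proof -
  interpret wf_digraph G by fact
  have cost: "awalk_cost (\<lambda>_. 1) p = real (length p)" for p
    by (induction p) auto
  show ?thesis
  proof
    assume le: "gdist G u v \<le> ereal (real n)"
    have "ereal (real n) < ereal (real n + 1)" by simp
    with le have "(INF p\<in>{p. awalk u p v}. ereal (awalk_cost (\<lambda>_. 1) p)) < ereal (real n + 1)"
      unfolding gdist_def \<mu>_def by (rule le_less_trans)
    then obtain p where "awalk u p v" "ereal (awalk_cost (\<lambda>_. 1) p) < ereal (real n + 1)"
      unfolding INF_less_iff by auto
    then show "\<exists>p. awalk u p v \<and> length p \<le> n"
      by (auto simp: cost)
  next
    assume "\<exists>p. awalk u p v \<and> length p \<le> n"
    then obtain p where p: "awalk u p v" "length p \<le> n" by auto
    from min_cost_le_walk_cost[OF p(1), of "\<lambda>_. 1"] p(2)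
    show "gdist G u v \<le> ereal (real n)"
      unfolding gdist_def cost by (meson ereal_less_eq(3) of_nat_le_iff order_trans)
  qed
qed

definition gball :: "nat \<Rightarrow> 'a \<Rightarrow> ('a, 'b) pre_digraph \<Rightarrow> 'a set" where
  "gball r v G = {x \<in> verts G. gdist G v x \<le> ereal (real r)}"

text \<open>
  The relation \<open>R\<close> is a reflexive well-order, with \<open>(w, v) \<in> R\<close> meaning that \<open>w\<close> precedes
  or equals \<open>v\<close>.
\<close>

definition dismantlable :: "nat \<Rightarrow> nat \<Rightarrow> ('a, 'b) pre_digraph \<Rightarrow> bool" where
  "dismantlable s s' G \<longleftrightarrow>
    (\<exists>R. well_order_on (verts G) R \<and>
      (\<forall>v\<in>verts G. \<not> (\<forall>w\<in>verts G. (v, w) \<in> R) \<longrightarrow>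
        (\<exists>u\<in>verts G. u \<noteq> v \<and> (u, v) \<in> R \<and>
          gball s v (pre_digraph.del_vert G u) \<inter> {w. (w, v) \<in> R} \<subseteq> gball s' u G)))"

definition triangle_condition :: "('a, 'b) pre_digraph \<Rightarrow> bool" where
  "triangle_condition G \<longleftrightarrow>
    (\<forall>u\<in>verts G. \<forall>v\<in>verts G. \<forall>w\<in>verts G.
      gdist G v w = 1 \<and> 1 < gdist G u v \<and> gdist G u v = gdist G u w \<longrightarrow>
      (\<exists>x\<in>verts G. x \<rightarrow>\<^bsub>G\<^esub> v \<and> x \<rightarrow>\<^bsub>G\<^esub> w \<and> gdist G u x = gdist G u v - 1))"

definition quadrangle_condition :: "('a, 'b) pre_digraph \<Rightarrow> bool" where
  "quadrangle_condition G \<longleftrightarrow>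
    (\<forall>u\<in>verts G. \<forall>v\<in>verts G. \<forall>w\<in>verts G. \<forall>z\<in>verts G.
      gdist G v z = 1 \<and> gdist G w z = 1 \<and> gdist G v w = 2 \<and> 2 \<le> gdist G u v \<and>
      gdist G u v = gdist G u w \<and> gdist G u w = gdist G u z - 1 \<longrightarrow>
      (\<exists>x\<in>verts G. x \<rightarrow>\<^bsub>G\<^esub> v \<and> x \<rightarrow>\<^bsub>G\<^esub> w \<and> gdist G u x = gdist G u v - 1))"

definition weakly_modular :: "('a, 'b) pre_digraph \<Rightarrow> bool" where
  "weakly_modular G \<longleftrightarrow> triangle_condition G \<and> quadrangle_condition G"

text \<open>
  After sorting in ascending order, the two largest of the three sums are the entries at
  positions 2 and 1.
\<close>

definition hyperbolic :: "real \<Rightarrow> ('a, 'b) pre_digraph \<Rightarrow> bool" where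
  "hyperbolic \<delta> G \<longleftrightarrow>
    (\<forall>u\<in>verts G. \<forall>v\<in>verts G. \<forall>x\<in>verts G. \<forall>y\<in>verts G.
      (let ds = sort [gdist G u v + gdist G x y,
                       gdist G u x + gdist G v y,
                       gdist G u y + gdist G v x]
      in ds ! 2 - ds ! 1 \<le> ereal (2 * \<delta>)))"

end

theory Submission
  imports Defs
begin

text \<open>
  The last vertex \<open>v\<close> of a finite set \<open>H\<close> in the dismantling order cannot be the midpoint of a geodesic
  of length \<open>2 * s\<close> inside \<open>H\<close>, because its dominating vertex would be too close to both ends. So
  there is no closed polygon all of whose subpaths of length \<open>2 * s\<close> are geodesic. In a weakly modular
  graph, metric triangles are strongly equilateral, and cutting off the three corners of one with
  side at least \<open>6 * s\<close> yields a hexagon of this kind; similarly for two vertices at distance at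
  least \<open>10 * s\<close> on the same level of an interval. With metric triangles of size below \<open>6 * s\<close> and
  intervals of thickness below \<open>10 * s\<close>, geodesics from a common origin to \<open>x\<close> and \<open>y\<close> stay
  \<open>26 * s\<close>-close up to the Gromov product of \<open>x\<close> and \<open>y\<close>, which gives the four-point condition.
\<close>

section \<open>Geodesic integer metrics\<close>

locale geodesic_metric =
  fixes V :: "'a set" and d :: "'a \<Rightarrow> 'a \<Rightarrow> nat"
  assumes d_eq_0: "x \<in> V \<Longrightarrow> y \<in> V \<Longrightarrow> d x y = 0 \<longleftrightarrow> x = y"
    and d_sym: "d x y = d y x"
    and d_triangle: "x \<in> V \<Longrightarrow> y \<in> V \<Longrightarrow> z \<in> V \<Longrightarrow> d x z \<le> d x y + d y z"
    and d_between: "x \<in> V \<Longrightarrow> y \<in> V \<Longrightarrow> i \<le> d x y \<Longrightarrow>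
      \<exists>z\<in>V. d x z = i \<and> d z y = d x y - i"
begin

lemma d_self [simp]: "x \<in> V \<Longrightarrow> d x x = 0"
  by (simp add: d_eq_0)

definition interval :: "'a \<Rightarrow> 'a \<Rightarrow> 'a set" where
  "interval x y = {p \<in> V. d x p + d p y = d x y}"

lemma interval_sym: "interval x y = interval y x"
  using d_sym by (auto simp: interval_def add.commute)

lemma interval_in: "p \<in> interval x y \<Longrightarrow> p \<in> V"
  by (simp add: interval_def)

lemma interval_d: "p \<in> interval x y \<Longrightarrow> d x p + d p y = d x y"
  by (simp add: interval_def)

lemma interval_trans:
  assumes "x \<in> V" "y \<in> V" "p \<in> interval x y" "q \<in> interval x p"
  shows "q \<in> interval x y"
  using assms d_triangle[of q p y] d_triangle[of x q y] by (auto simp: interval_def)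

lemma interval_point:
  assumes "x \<in> V" "y \<in> V" "i \<le> d x y"
  obtains p where "p \<in> interval x y" "d x p = i" "d p y = d x y - i"
  using d_between[OF assms] assms(3) by (auto simp: interval_def)

section \<open>Geodesics as vertex sequences\<close>

definition geodesic :: "'a \<Rightarrow> 'a \<Rightarrow> (nat \<Rightarrow> 'a) \<Rightarrow> bool" where
  "geodesic x y g \<longleftrightarrow> g 0 = x \<and> g (d x y) = y \<and>
    (\<forall>i \<le> d x y. g i \<in> V) \<and> (\<forall>j \<le> d x y. \<forall>i \<le> j. d (g i) (g j) = j - i)"

lemma geodesic_exists:
  assumes "x \<in> V" "y \<in> V"
  shows "\<exists>g. geodesic x y g"
  using assms
proof (induction "d x y" arbitrary: y)
  case 0
  then have "x = y" using d_eq_0 by metis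
  with 0 have "geodesic x y (\<lambda>_. x)" by (simp add: geodesic_def)
  then show ?case by blast
next
  case (Suc n)
  obtain z where z: "z \<in> V" "d x z = n" "d z y = 1"
    using d_between[of x y n] Suc by auto
  obtain g where g: "geodesic x z g" using Suc.hyps(1)[of z] Suc.prems z by auto
  have gV: "g i \<in> V" if "i \<le> n" for i using g that z by (simp add: geodesic_def)
  have gd: "d (g i) (g j) = j - i" if "j \<le> n" "i \<le> j" for i j
    using g that z by (simp add: geodesic_def)
  have g0: "g 0 = x" "g n = z" using g z by (auto simp: geodesic_def)
  have gy: "d (g i) y = Suc n - i" if "i \<le> n" for i
    using d_triangle[of "g i" z y] d_triangle[of x "g i" y] gd[of n i] gd[of i 0] g0 gV[OF that]
      Suc.hyps(2) Suc.prems z that by auto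
  have "geodesic x y (g(Suc n := y))"
    using Suc.hyps(2)[symmetric] Suc.prems g0 gV gd gy
    by (auto simp: geodesic_def le_Suc_eq)
  then show ?case by blast
qed

text \<open>A shortcut between a vertex of \<open>f\<close> and one of \<open>g\<close> would give a
  path from \<open>x\<close> to \<open>z\<close> shorter than \<open>d x y + d y z\<close>, so
  additivity of the end distances makes the concatenation geodesic.\<close>

lemma geodesic_append:
  assumes V: "x \<in> V" "y \<in> V" "z \<in> V"
    and f: "geodesic x y f" and g: "geodesic y z g"
    and sum: "d x z = d x y + d y z"
  shows "geodesic x z (\<lambda>i. if i \<le> d x y then f i else g (i - d x y))"
proof -
  let ?l = "d x y"
  have fd: "d (f i) (f j) = j - i" if "j \<le> ?l" "i \<le> j" for i j
    using f that by (simp add: geodesic_def)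
  have gd: "d (g i) (g j) = j - i" if "j \<le> d y z" "i \<le> j" for i j
    using g that by (simp add: geodesic_def)
  have fV: "f i \<in> V" if "i \<le> ?l" for i using f that by (simp add: geodesic_def)
  have gV: "g i \<in> V" if "i \<le> d y z" for i using g that by (simp add: geodesic_def)
  have e: "f 0 = x" "f ?l = y" "g 0 = y" "g (d y z) = z"
    using f g by (auto simp: geodesic_def)
  have cross: "d (f i) (g j) = (?l - i) + j" if "i \<le> ?l" "j \<le> d y z" for i j
  proof -
    have "d (f i) (g j) \<le> d (f i) y + d y (g j)"
      using d_triangle fV[OF that(1)] gV[OF that(2)] V by blast
    moreover have "d x z \<le> d x (f i) + d (f i) (g j) + d (g j) z"
      using d_triangle[of x "f i" z] d_triangle[of "f i" "g j" z]
        fV[OF that(1)] gV[OF that(2)] V by auto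
    ultimately show ?thesis
      using fd[of ?l i] fd[of i 0] gd[of j 0] gd[of "d y z" j] e that sum by auto
  qed
  show ?thesis
    unfolding geodesic_def
  proof (intro conjI allI impI)
    show "(if d x z \<le> ?l then f (d x z) else g (d x z - ?l)) = z"
      using e sum by auto
  next
    fix i assume "i \<le> d x z"
    then show "(if i \<le> ?l then f i else g (i - ?l)) \<in> V" using fV gV sum by auto
  next
    fix j i assume "j \<le> d x z" "i \<le> j"
    then show "d (if i \<le> ?l then f i else g (i - ?l)) (if j \<le> ?l then f j else g (j - ?l)) = j - i"
      using fd gd cross[of i "j - ?l"] sum by auto
  qed (use e in auto)
qed

section \<open>Locally geodesic polygons\<close>

definition midpoint_in :: "nat \<Rightarrow> 'a set \<Rightarrow> 'a \<Rightarrow> bool" where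
  "midpoint_in s H v \<longleftrightarrow> (\<exists>g. g s = v \<and> (\<forall>i \<le> 2 * s. g i \<in> H) \<and>
    (\<forall>j \<le> 2 * s. \<forall>i \<le> j. d (g i) (g j) = j - i))"

lemma midpoint_in_geodesic:
  assumes g: "geodesic x y g" and H: "\<And>i. i \<le> d x y \<Longrightarrow> g i \<in> H"
    and k: "s \<le> k" "k + s \<le> d x y"
  shows "midpoint_in s H (g k)"
  unfolding midpoint_in_def
proof (intro exI[of _ "\<lambda>i. g (k - s + i)"] conjI allI impI)
  fix i assume "i \<le> 2 * s"
  then show "g (k - s + i) \<in> H" using H[of "k - s + i"] k by auto
next
  fix j i assume "j \<le> 2 * s" "i \<le> j"
  then show "d (g (k - s + i)) (g (k - s + j)) = j - i"
    using g k by (auto simp: geodesic_def)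
qed (use k in auto)

text \<open>
  The pairs in \<open>E\<close> are the directed sides of a polygon (or of several polygons), whose corners
  are locally geodesic.
\<close>

lemma polygon_midpoints:
  assumes fin: "finite E" and "E \<noteq> {}" and EV: "E \<subseteq> V \<times> V"
    and long: "\<And>a b. (a, b) \<in> E \<Longrightarrow> 2 * s \<le> d a b"
    and pred: "\<And>a b. (a, b) \<in> E \<Longrightarrow> \<exists>z. (z, a) \<in> E \<and> d z b = d z a + d a b"
    and succ: "\<And>a b. (a, b) \<in> E \<Longrightarrow> \<exists>c. (b, c) \<in> E \<and> d a c = d a b + d b c"
  shows "\<exists>H. finite H \<and> H \<noteq> {} \<and> H \<subseteq> V \<and> (\<forall>v\<in>H. midpoint_in s H v)"
proof -
  define \<gamma> where "\<gamma> a b = (SOME g. geodesic a b g)" for a b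
  have \<gamma>: "geodesic a b (\<gamma> a b)" if "(a, b) \<in> E" for a b
    unfolding \<gamma>_def by (rule someI_ex[of "geodesic a b"], rule geodesic_exists) (use that EV in auto)
  define H where "H = (\<Union>(a, b)\<in>E. \<gamma> a b ` {..d a b})"
  have HI: "\<gamma> a b i \<in> H" if "(a, b) \<in> E" "i \<le> d a b" for a b i
    using that by (auto simp: H_def)
  \<comment> \<open>Each side carries one fixed geodesic, so two consecutive sides concatenate to a
    geodesic that stays in \<open>H\<close> and has both of them as pieces.\<close>
  have join: "\<exists>f. geodesic a c f \<and> (\<forall>i \<le> d a c. f i \<in> H) \<and>
      (\<forall>i \<le> d a b. f i = \<gamma> a b i) \<and> (\<forall>i \<le> d b c. f (d a b + i) = \<gamma> b c i)"
    if E: "(a, b) \<in> E" "(b, c) \<in> E" and sum: "d a c = d a b + d b c" for a b c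
  proof -
    let ?f = "\<lambda>i. if i \<le> d a b then \<gamma> a b i else \<gamma> b c (i - d a b)"
    have "geodesic a c ?f"
      using geodesic_append[OF _ _ _ \<gamma>[OF E(1)] \<gamma>[OF E(2)] sum] E EV by auto
    moreover have "\<forall>i \<le> d a c. ?f i \<in> H" using HI E sum by auto
    moreover have "\<gamma> a b (d a b) = b" "\<gamma> b c 0 = b"
      using \<gamma>[OF E(1)] \<gamma>[OF E(2)] by (auto simp: geodesic_def)
    then have "\<forall>i \<le> d b c. ?f (d a b + i) = \<gamma> b c i" by auto
    moreover have "\<forall>i \<le> d a b. ?f i = \<gamma> a b i" by simp
    ultimately show ?thesis by blast
  qed
  have "midpoint_in s H v" if "v \<in> H" for v
  proof -
    obtain a b i where E: "(a, b) \<in> E" and i: "i \<le> d a b" and v: "v = \<gamma> a b i"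
      using \<open>v \<in> H\<close> by (auto simp: H_def)
    \<comment> \<open>If at least \<open>s\<close> steps remain on the side after \<open>v\<close>,
      the previous side is prefixed to supply the steps before \<open>v\<close>; otherwise
      \<open>v\<close> already has \<open>s\<close> steps before it, and the next side supplies
      those after it.\<close>
    show ?thesis
    proof (cases "i + s \<le> d a b")
      case True
      obtain z where z: "(z, a) \<in> E" "d z b = d z a + d a b" using pred E by blast
      from join[OF z(1) E z(2)] obtain f where f: "geodesic z b f"
        "\<forall>i \<le> d z b. f i \<in> H" "\<forall>i \<le> d a b. f (d z a + i) = \<gamma> a b i" by blast
      have "midpoint_in s H (f (d z a + i))"
        using midpoint_in_geodesic[OF f(1)] f(2) True z long[OF z(1)] by auto
      then show ?thesis using f(3) i v by simp
    next
      case False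
      obtain c where c: "(b, c) \<in> E" "d a c = d a b + d b c" using succ E by blast
      from join[OF E c(1) c(2)] obtain f where f: "geodesic a c f"
        "\<forall>i \<le> d a c. f i \<in> H" "\<forall>i \<le> d a b. f i = \<gamma> a b i" by blast
      have "midpoint_in s H (f i)"
        using midpoint_in_geodesic[OF f(1)] f(2) False i c long[OF c(1)] long[OF E] by auto
      then show ?thesis using f(3) i v by simp
    qed
  qed
  moreover have "finite H" using fin by (auto simp: H_def)
  moreover have "H \<noteq> {}" using \<open>E \<noteq> {}\<close> by (auto simp: H_def)
  moreover have "H \<subseteq> V" using \<gamma> by (auto simp: H_def geodesic_def)
  ultimately show ?thesis by blast
qed

lemma hexagon_midpoints:
  assumes "p \<in> V" "q \<in> V" "r \<in> V" "p' \<in> V" "q' \<in> V" "r' \<in> V"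
    and "2 * s \<le> d p q" "2 * s \<le> d q r" "2 * s \<le> d r p'"
      "2 * s \<le> d p' q'" "2 * s \<le> d q' r'" "2 * s \<le> d r' p"
    and "d p r = d p q + d q r" "d q p' = d q r + d r p'" "d r q' = d r p' + d p' q'"
      "d p' r' = d p' q' + d q' r'" "d q' p = d q' r' + d r' p" "d r' q = d r' p + d p q"
  shows "\<exists>H. finite H \<and> H \<noteq> {} \<and> H \<subseteq> V \<and> (\<forall>v\<in>H. midpoint_in s H v)"
proof (rule polygon_midpoints[of "{(p, q), (q, r), (r, p'), (p', q'), (q', r'), (r', p)}"])
  fix a b
  assume "(a, b) \<in> {(p, q), (q, r), (r, p'), (p', q'), (q', r'), (r', p)}"
  then consider "a = p" "b = q" | "a = q" "b = r" | "a = r" "b = p'"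
    | "a = p'" "b = q'" | "a = q'" "b = r'" | "a = r'" "b = p" by auto
  note cs = this
  show "2 * s \<le> d a b" using cs assms by cases simp_all
  show "\<exists>z. (z, a) \<in> {(p, q), (q, r), (r, p'), (p', q'), (q', r'), (r', p)} \<and>
      d z b = d z a + d a b"
    using cs assms(13-) by cases blast+
  show "\<exists>c. (b, c) \<in> {(p, q), (q, r), (r, p'), (p', q'), (q', r'), (r', p)} \<and>
      d a c = d a b + d b c"
    using cs assms(13-) by cases blast+
qed (use assms in auto)

section \<open>Metric triangles and quasi-medians\<close>

definition metric_triangle :: "'a \<Rightarrow> 'a \<Rightarrow> 'a \<Rightarrow> bool" where
  "metric_triangle x y z \<longleftrightarrow> x \<in> V \<and> y \<in> V \<and> z \<in> V \<and>
    interval x y \<inter> interval x z \<subseteq> {x} \<and>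
    interval y x \<inter> interval y z \<subseteq> {y} \<and>
    interval z x \<inter> interval z y \<subseteq> {z}"

lemma metric_triangle_rotate: "metric_triangle x y z \<Longrightarrow> metric_triangle y z x"
  by (auto simp: metric_triangle_def)

lemma metric_triangle_swap: "metric_triangle x y z \<Longrightarrow> metric_triangle x z y"
  by (auto simp: metric_triangle_def)

text \<open>A quasi-median is a metric triangle \<open>x' y' z'\<close> with this property.\<close>

definition pre_quasi_median :: "'a \<Rightarrow> 'a \<Rightarrow> 'a \<Rightarrow> 'a \<Rightarrow> 'a \<Rightarrow> 'a \<Rightarrow> bool" where
  "pre_quasi_median x y z x' y' z' \<longleftrightarrow> x' \<in> V \<and> y' \<in> V \<and> z' \<in> V \<and>
    d x y = d x x' + d x' y' + d y' y \<and>
    d y z = d y y' + d y' z' + d z' z \<and>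
    d x z = d x x' + d x' z' + d z' z"

lemma pre_quasi_median_rotate:
  assumes "pre_quasi_median x y z x' y' z'"
  shows "pre_quasi_median y z x y' z' x'"
  using assms d_sym[of z x] d_sym[of z z'] d_sym[of z' x'] d_sym[of x' x] d_sym[of y x] d_sym[of y y']
    d_sym[of y' x']
  by (auto simp: pre_quasi_median_def)

text \<open>Each equation says that a path through two primed vertices has the least possible
  length, so every triangle inequality along it is an equality.\<close>

lemma pre_quasi_median_intervals:
  assumes "x \<in> V" "y \<in> V" "z \<in> V" "pre_quasi_median x y z x' y' z'"
  shows "x' \<in> interval x y" "x' \<in> interval x z" "y' \<in> interval x y"
    "y' \<in> interval y z" "z' \<in> interval x z" "z' \<in> interval y z"
  using assms d_triangle[of x' y' y] d_triangle[of x x' y] d_triangle[of x x' y']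
    d_triangle[of x y' y] d_triangle[of x' z' z] d_triangle[of x x' z] d_triangle[of x x' z']
    d_triangle[of x z' z] d_triangle[of y y' z'] d_triangle[of y z' z] d_triangle[of y y' z]
    d_triangle[of y' z' z] d_sym[of y y']
  by (auto simp: pre_quasi_median_def interval_def)

text \<open>The stretch from \<open>x'\<close> to \<open>p\<close> is moved from the two sides at
  \<open>x'\<close> to the leg starting at \<open>x\<close>.\<close>

lemma pre_quasi_median_shrink:
  assumes V: "x \<in> V" "y \<in> V" "z \<in> V" and g: "pre_quasi_median x y z x' y' z'"
    and p: "p \<in> interval x' y'" "p \<in> interval x' z'"
  shows "pre_quasi_median x y z p y' z'"
  using assms d_triangle[of x x' p] d_triangle[of x p y] d_triangle[of p y' y]
  by (auto simp: pre_quasi_median_def interval_def)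

text \<open>Take a triple of least perimeter, \<open>(x, y, z)\<close> being one candidate. A second
  common vertex \<open>p\<close> of the two intervals at a corner could replace that corner, which
  lowers the perimeter by twice the distance moved.\<close>

lemma quasi_median_exists:
  assumes V: "x \<in> V" "y \<in> V" "z \<in> V"
  obtains x' y' z' where "pre_quasi_median x y z x' y' z'" "metric_triangle x' y' z'"
proof -
  define P where "P = (\<lambda>(x', y', z'). pre_quasi_median x y z x' y' z')"
  define m where "m = (\<lambda>(x', y', z'). d x' y' + d y' z' + d x' z')"
  have "P (x, y, z)" using V by (simp add: P_def pre_quasi_median_def)
  then obtain t where t: "P t" "\<And>t'. P t' \<Longrightarrow> m t \<le> m t'"
    using ex_has_least_nat[of P _ m] by blast
  obtain x' y' z' where [simp]: "t = (x', y', z')" by (cases t)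
  have g: "pre_quasi_median x y z x' y' z'" using t(1) by (simp add: P_def)
  have min: "d x' y' + d y' z' + d x' z' \<le> d p q + d q r + d p r"
    if "pre_quasi_median x y z p q r" for p q r
    using t(2)[of "(p, q, r)"] that by (simp add: P_def m_def)
  have V': "x' \<in> V" "y' \<in> V" "z' \<in> V" using g by (auto simp: pre_quasi_median_def)
  have "p = x'" if p: "p \<in> interval x' y'" "p \<in> interval x' z'" for p
    using min[OF pre_quasi_median_shrink[OF V g p]] p V' d_eq_0[of x' p] by (auto simp: interval_def)
  \<comment> \<open>The other two corners are rotated into first position, shrunk there and rotated
    back.\<close>
  moreover have "p = y'" if p: "p \<in> interval y' x'" "p \<in> interval y' z'" for p
    using min[OF pre_quasi_median_rotate[OF pre_quasi_median_rotate[OF pre_quasi_median_shrink[OF V(2,3,1)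
            pre_quasi_median_rotate[OF g] p(2,1)]]]] p V' d_eq_0[of y' p] d_sym[of p x'] d_sym[of y' x']
    by (auto simp: interval_def)
  moreover have "p = z'" if p: "p \<in> interval z' x'" "p \<in> interval z' y'" for p
    using min[OF pre_quasi_median_rotate[OF pre_quasi_median_shrink[OF V(3,1,2)
            pre_quasi_median_rotate[OF pre_quasi_median_rotate[OF g]] p]]] p V' d_eq_0[of z' p]
      d_sym[of p x'] d_sym[of z' x'] d_sym[of p y'] d_sym[of z' y']
    by (auto simp: interval_def)
  ultimately have "metric_triangle x' y' z'" using V' by (auto simp: metric_triangle_def)
  with g show ?thesis using that by blast
qed

end

section \<open>Weakly modular metrics\<close>

text \<open>Both conditions include the case \<open>d u v = 1\<close>, where \<open>u\<close> itself
  is a witness; writing \<open>+ 1\<close> avoids truncated subtraction.\<close>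

locale weakly_modular_metric = geodesic_metric +
  assumes triangle_cond:
    "u \<in> V \<Longrightarrow> v \<in> V \<Longrightarrow> w \<in> V \<Longrightarrow> d v w = 1 \<Longrightarrow> d u v = d u w \<Longrightarrow>
      \<exists>x\<in>V. d v x = 1 \<and> d w x = 1 \<and> d u x + 1 = d u v"
    and quadrangle_cond:
    "u \<in> V \<Longrightarrow> v \<in> V \<Longrightarrow> w \<in> V \<Longrightarrow> z \<in> V \<Longrightarrow> d v z = 1 \<Longrightarrow> d w z = 1 \<Longrightarrow>
      d v w = 2 \<Longrightarrow> d u v = d u w \<Longrightarrow> d u z = d u v + 1 \<Longrightarrow>
      \<exists>x\<in>V. d v x = 1 \<and> d w x = 1 \<and> d u x + 1 = d u v"
begin

text \<open>Induction on \<open>d v w\<close>. A vertex of \<open>interval v w\<close> other than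
  \<open>w\<close> that is closer to \<open>u\<close> than \<open>v\<close> is reduces the claim to
  a shorter distance. In a counterexample this fixes the distances to \<open>u\<close> near
  \<open>w\<close> so tightly that the triangle and quadrangle conditions produce such a vertex
  after all.\<close>

lemma step_towards_both:
  assumes "u \<in> V" "v \<in> V" "w \<in> V" "d u w < d u v"
  shows "\<exists>x\<in>V. d v x = 1 \<and> d u x + 1 = d u v \<and> d x w + 1 = d v w"
  using assms
proof (induction "d v w" arbitrary: u v w rule: less_induct)
  case less
  note V = less.prems(1-3)
  let ?k = "d u v" and ?l = "d v w"
  let ?goal = "\<exists>x\<in>V. d v x = 1 \<and> d u x + 1 = ?k \<and> d x w + 1 = ?l"
  have "v \<noteq> w" using less.prems by auto
  then have "?l > 0" using V d_eq_0 by (metis not_gr_zero)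
  have extend: ?goal
    if q: "q \<in> interval v w" "q \<noteq> w" "d u q < d u v" for q
  proof -
    have qV: "q \<in> V" using q interval_in by blast
    have "d q w > 0" using q qV V d_eq_0[of q w] by auto
    then have "d v q < d v w" using interval_d[OF q(1)] by simp
    then obtain x where x: "x \<in> V" "d v x = 1" "d u x + 1 = d u v" "d x q + 1 = d v q"
      using less.hyps[OF _ V(1,2) qV q(3)] by auto
    then show ?thesis
      using d_triangle[of x q w] d_triangle[of v x w] interval_d[OF q(1)] qV V by force
  qed
  show ?case
  proof (cases "?l = 1")
    case True
    then show ?thesis using V less.prems(4) d_triangle[of u w v] d_sym[of w v]
      by (intro bexI[of _ w]) auto
  next
    case False
    then have l2: "?l \<ge> 2" using \<open>?l > 0\<close> by simp
    obtain m where m: "m \<in> interval v w" "d v m = ?l - 1" "d m w = 1"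
      using interval_point[of v w "?l - 1"] V l2 by auto
    have mV: "m \<in> V" using m interval_in by blast
    have wu: "d u w + 1 = ?k \<and> d u m = ?k" if *: "\<not> ?goal"
    proof -
      have "d u m \<ge> ?k" using extend[of m] * m V mV by force
      then show ?thesis using d_triangle[of u w m] V mV m(3) d_sym[of w m] less.prems(4) by simp
    qed
    obtain n where n: "n \<in> interval v m" "d v n = ?l - 2" "d n m = 1"
    proof -
      have "?l - 2 \<le> d v m" using m l2 by simp
      from interval_point[OF V(2) mV this] that m l2 show ?thesis by auto
    qed
    have nV: "n \<in> V" using n interval_in by blast
    have below: ?goal if q: "q \<in> V" "d v q \<le> ?l - 2" "d q m = 1" "d u q < ?k" for q
    proof -
      have "d v q + d q w = d v w"
        using d_triangle[of v q w] d_triangle[of q m w] q V mV m l2 by auto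
      then have "q \<in> interval v w" "q \<noteq> w" using q l2 by (auto simp: interval_def)
      then show ?thesis using extend q by blast
    qed
    show ?thesis
    proof (rule ccontr)
      assume neg: "\<not> ?thesis"
      have k: "d u w + 1 = ?k" "d u m = ?k" using wu neg by auto
      have no_ext: "d u q \<ge> ?k" if "q \<in> interval v w" "q \<noteq> w" for q
        using extend[OF that] neg by fastforce
      have no_below: "d u q \<ge> ?k" if "q \<in> V" "d v q \<le> ?l - 2" "d q m = 1" for q
        using below[OF that] neg by fastforce
      have "d u n \<ge> ?k" using no_below[of n] n nV by simp
      moreover have "d u n \<le> ?k + 1" using d_triangle[of u m n] k V mV nV n d_sym[of n m] by simp
      ultimately consider "d u n = ?k" | "d u n = ?k + 1" by linarith
      then show False
      proof cases
        case 1
        \<comment> \<open>The edge from \<open>n\<close> to \<open>m\<close> is level seen from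
          \<open>u\<close>: a triangle gives \<open>x\<close> below it, and the quadrangle below
          \<open>x\<close>, \<open>m\<close>, \<open>w\<close> then gives \<open>y\<close> at
          distance \<open>?k - 2\<close> from \<open>u\<close>.\<close>
        obtain x where x: "x \<in> V" "d n x = 1" "d m x = 1" "d u x + 1 = ?k"
          using triangle_cond[of u n m] 1 k V mV nV n by auto
        have vx: "d v x = ?l - 1"
          using no_below[of x] d_triangle[of v n x] x n m V nV d_sym[of m x] l2 by fastforce
        have xw: "d x w = 2"
        proof -
          have "x \<noteq> w" using vx l2 by auto
          then have "d x w \<noteq> 0" using x V d_eq_0 by metis
          moreover have "d x w \<noteq> 1"
            using no_ext[of x] \<open>x \<noteq> w\<close> vx x l2 by (auto simp: interval_def)
          moreover have "d x w \<le> 2" using d_triangle[of x m w] x m V mV d_sym[of m x] by simp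
          ultimately show ?thesis by linarith
        qed
        obtain y where y: "y \<in> V" "d x y = 1" "d w y = 1" "d u y + 2 = ?k"
          using quadrangle_cond[of u x w m] x V mV m xw k d_sym[of w m] d_sym[of m x]
          by fastforce
        have "d v y \<le> ?l" using d_triangle[of v x y] vx x y V l2 by simp
        moreover have "d v y \<ge> ?l - 1" using d_triangle[of v y w] y V d_sym[of w y] by simp
        ultimately consider "d v y = ?l - 1" | "d v y = ?l" by linarith
        then show False
        proof cases
          case 1
          then have "y \<in> interval v w" "y \<noteq> w"
            using y d_sym[of w y] l2 by (auto simp: interval_def)
          then show False using no_ext[of y] y by simp
        next
          case 2
          \<comment> \<open>Now \<open>w\<close> and \<open>y\<close> are level seen from
            \<open>v\<close>. The vertex \<open>t\<close> below them lies in
            \<open>interval v w\<close> and inherits \<open>d u t < ?k\<close> from its neighbor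
            \<open>y\<close>.\<close>
          obtain t where t: "t \<in> V" "d w t = 1" "d y t = 1" "d v t + 1 = ?l"
            using triangle_cond[of v w y] 2 y V by auto
          then have "t \<in> interval v w" "t \<noteq> w"
            using d_sym[of w t] by (auto simp: interval_def)
          then show False using no_ext[of t] d_triangle[of u y t] t y V by simp
        qed
      next
        case 2
        have nv: "d n v = ?l - 2" using n d_sym by metis
        \<comment> \<open>Since \<open>n\<close> is farther from \<open>u\<close> than
          \<open>v\<close> is, the induction hypothesis applies with \<open>n\<close> as
          \<open>v\<close> and \<open>v\<close> as \<open>w\<close>. The neighbors \<open>p\<close>
          and \<open>m\<close> of \<open>n\<close> then span a quadrangle whose fourth vertex is too
          close to \<open>u\<close>.\<close>
        obtain p where p: "p \<in> V" "d n p = 1" "d u p = ?k" "d p v + 1 = ?l - 2"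
          using less.hyps[of n v u] nv 2 V nV l2 by fastforce
        have "d p m = 2"
          using d_triangle[of v p m] d_triangle[of p n m] p n nV m V mV d_sym[of n p] d_sym[of v p]
            l2 by fastforce
        then obtain q where q: "q \<in> V" "d p q = 1" "d m q = 1" "d u q + 1 = ?k"
          using quadrangle_cond[of u p m n] p V mV nV n k 2 d_sym[of n p] d_sym[of m n] by fastforce
        have "d v q \<le> ?l - 2" using d_triangle[of v p q] q p V d_sym[of v p] by simp
        then show False using no_below[of q] q d_sym[of m q] by simp
      qed
    qed
  qed
qed

text \<open>Otherwise \<open>step_towards_both\<close> yields a neighbor of \<open>v\<close> lying
  in both intervals.\<close>

lemma corner_le:
  assumes "u \<in> V" "v \<in> V" "w \<in> V" "interval v u \<inter> interval v w \<subseteq> {v}"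
  shows "d u v \<le> d u w"
proof (rule ccontr)
  assume "\<not> ?thesis"
  then obtain x where x: "x \<in> V" "d v x = 1" "d u x + 1 = d u v" "d x w + 1 = d v w"
    using step_towards_both[of u v w] assms by auto
  then have "x \<in> interval v u \<inter> interval v w"
    using d_sym[of x u] d_sym[of v u] by (auto simp: interval_def)
  then show False using assms x by auto
qed

lemma metric_triangle_equilateral:
  assumes "metric_triangle x y z"
  shows "d x y = d x z" "d y z = d x z"
  using assms corner_le[of x y z] corner_le[of y x z] corner_le[of x z y] corner_le[of z x y]
    corner_le[of y z x] corner_le[of z y x] d_sym[of x y] d_sym[of x z] d_sym[of y z]
  by (auto simp: metric_triangle_def Int_commute)

text \<open>This is strong equilaterality. For the lower bound, \<open>y\<close> remains a corner
  when \<open>z\<close> is replaced by a vertex of the side. For the upper bound, a side vertex that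
  is too far has side neighbors towards \<open>y\<close> and towards \<open>z\<close> that are
  closer to \<open>x\<close>; by induction they are at distance exactly \<open>d x y\<close>, and
  the quadrangle below them gives a side vertex violating the lower bound.\<close>

lemma metric_triangle_opposite_side:
  assumes t: "metric_triangle x y z" and p: "p \<in> interval y z"
  shows "d x p = d x y"
proof -
  have V: "x \<in> V" "y \<in> V" "z \<in> V" using t by (auto simp: metric_triangle_def)
  have eq: "d x z = d x y" using metric_triangle_equilateral[OF t] by simp
  have lower: "d x q \<ge> d x y" if "q \<in> interval y z" for q
  proof -
    have "interval y x \<inter> interval y q \<subseteq> {y}"
      using interval_trans[OF V(2,3) that] t by (auto simp: metric_triangle_def)
    then show ?thesis using corner_le[of x y q] V interval_in[OF that] by simp
  qed
  have "\<not> d x y < d x p"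
    using p
  proof (induction "d x p" arbitrary: p rule: less_induct)
    case less
    have pV: "p \<in> V" using less.prems interval_in by blast
    show ?case
    proof
      assume far: "d x y < d x p"
      obtain a where a: "a \<in> V" "d p a = 1" "d x a + 1 = d x p" "d a y + 1 = d p y"
        using step_towards_both[of x p y] far V pV by auto
      obtain b where b: "b \<in> V" "d p b = 1" "d x b + 1 = d x p" "d b z + 1 = d p z"
        using step_towards_both[of x p z] far V pV eq by auto
      note p = interval_d[OF less.prems]
      note syms = d_sym[of p y] d_sym[of a y] d_sym[of b y] d_sym[of p a] d_sym[of p b] d_sym[of b z]
      have "a \<in> interval y z"
        using a p d_triangle[of a p z] d_triangle[of y a z] V pV syms by (auto simp: interval_def)
      then have "\<not> d x y < d x a" using less.hyps[of a] a by simp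
      then have "d x a = d x y" using lower \<open>a \<in> interval y z\<close> by force
      moreover have "d a b = 2"
        using d_triangle[of a p b] d_triangle[of y a z] d_triangle[of a b z] a b p V pV syms by auto
      ultimately obtain r where r: "r \<in> V" "d a r = 1" "d b r = 1" "d x r + 1 = d x a"
        using quadrangle_cond[of x a b p] a b V pV syms by fastforce
      have "r \<in> interval y z"
        using r a b p d_triangle[of y a r] d_triangle[of r b z] d_triangle[of y r z] V syms d_sym[of b r]
        by (auto simp: interval_def)
      then show False using lower[of r] r \<open>d x a = d x y\<close> by simp
    qed
  qed
  with lower[OF p] show ?thesis by simp
qed

text \<open>The vertex \<open>b\<close> comes from the quasi-median of \<open>x\<close>,
  \<open>a\<close>, \<open>z\<close>. Its first corner is \<open>x\<close>, as the sides at
  \<open>x\<close> meet only there; its second is \<open>a\<close>, since all vertices of the side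
  from \<open>x\<close> to \<open>y\<close> are equidistant from \<open>z\<close>.\<close>

lemma metric_triangle_sub:
  assumes t: "metric_triangle x y z" and a: "a \<in> interval x y"
  obtains b where "b \<in> interval x z" "d x b = d x a" "d a b = d x a"
proof -
  have V: "x \<in> V" "y \<in> V" "z \<in> V" using t by (auto simp: metric_triangle_def)
  have aV: "a \<in> V" using a interval_in by blast
  obtain x' a' b where g: "pre_quasi_median x a z x' a' b" and t': "metric_triangle x' a' b"
    using quasi_median_exists[OF V(1) aV V(3)] by blast
  note i = pre_quasi_median_intervals[OF V(1) aV V(3) g]
  have "x' = x" using interval_trans[OF V(1,2) a i(1)] i(2) t by (auto simp: metric_triangle_def)
  have "a' \<in> interval x y" using interval_trans[OF V(1,2) a i(3)] .
  then have "d z a' = d z a"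
    using metric_triangle_opposite_side[OF metric_triangle_rotate[OF metric_triangle_rotate[OF t]]] a
    by simp
  then have "d a a' = 0"
    using interval_d[OF i(4)] d_sym[of z a] d_sym[of z a'] by linarith
  then have "a' = a" using d_eq_0 aV interval_in[OF i(4)] by metis
  show ?thesis
  proof (rule that)
    show "b \<in> interval x z" by (fact i(5))
    show "d x b = d x a" "d a b = d x a"
      using metric_triangle_equilateral[OF t'] unfolding \<open>x' = x\<close> \<open>a' = a\<close> by linarith+
  qed
qed

end

section \<open>Metrics without locally geodesic polygons\<close>

locale thin_metric = weakly_modular_metric +
  fixes s :: nat
  assumes s_pos: "0 < s"
    and no_midpoints: "finite H \<Longrightarrow> H \<noteq> {} \<Longrightarrow> H \<subseteq> V \<Longrightarrow> \<exists>v\<in>H. \<not> midpoint_in s H v"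
begin

lemma no_hexagon:
  assumes "p \<in> V" "q \<in> V" "r \<in> V" "p' \<in> V" "q' \<in> V" "r' \<in> V"
    and "2 * s \<le> d p q" "2 * s \<le> d q r" "2 * s \<le> d r p'"
      "2 * s \<le> d p' q'" "2 * s \<le> d q' r'" "2 * s \<le> d r' p"
    and "d p r = d p q + d q r" "d q p' = d q r + d r p'" "d r q' = d r p' + d p' q'"
      "d p' r' = d p' q' + d q' r'" "d q' p = d q' r' + d r' p" "d r' q = d r' p + d p q"
  shows False
  using hexagon_midpoints[OF assms] no_midpoints by metis

text \<open>
  The hexagon is \<open>a, a2, c, c2, b2, b\<close>, with sides of length \<open>r\<close> and \<open>l\<close> alternating. Choosing \<open>b2\<close> and
  \<open>c2\<close> on the sides of the quasi-median of \<open>z, b, c\<close> is what makes it close up; independent choices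
  at the three corners need not fit together.
\<close>

lemma metric_triangle_small:
  assumes t: "metric_triangle x y z"
  shows "d x y < 6 * s"
proof (rule ccontr)
  define r where "r = 2 * s"
  assume "\<not> ?thesis"
  then have "3 * r \<le> d x y" by (simp add: r_def)
  then obtain l where l: "d x y = 2 * r + l" "r \<le> l"
    using le_Suc_ex[of "2 * r" "d x y"] by auto
  have V: "x \<in> V" "y \<in> V" "z \<in> V" using t by (auto simp: metric_triangle_def)
  have ty: "metric_triangle y z x" and tz: "metric_triangle z x y"
    using t metric_triangle_rotate by blast+
  have xz: "d x z = 2 * r + l" and yz: "d y z = 2 * r + l"
    using metric_triangle_equilateral[OF t] l by simp_all
  have yx: "d y x = 2 * r + l" and zx: "d z x = 2 * r + l" and zy: "d z y = 2 * r + l"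
    using l xz yz d_sym by metis+
  have x_opp: "d x p = 2 * r + l" if "p \<in> interval y z" for p
    using metric_triangle_opposite_side[OF t that] l by simp
  have y_opp: "d y p = 2 * r + l" if "p \<in> interval z x" for p
    using metric_triangle_opposite_side[OF ty that] yz by simp
  have z_opp: "d z p = 2 * r + l" if "p \<in> interval x y" for p
    using metric_triangle_opposite_side[OF tz that] zx by simp
  have "r \<le> d x y" using l by simp
  from interval_point[OF V(1,2) this]
  obtain a where a: "a \<in> interval x y" "d x a = r" "d a y = r + l" using l by auto
  have aV: "a \<in> V" using a(1) interval_in by blast
  have "d y a = r + l" using a(3) d_sym by metis
  then have "r \<le> d y a" by simp
  from interval_point[OF V(2) aV this]
  obtain a2 where a2: "a2 \<in> interval y a" "d y a2 = r" "d a2 a = l"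
    using \<open>d y a = r + l\<close> by auto
  have a2V: "a2 \<in> V" using a2(1) interval_in by blast
  have a2y: "a2 \<in> interval y x"
    using interval_trans[OF V(2,1) _ a2(1)] a(1) interval_sym by blast
  obtain b where b: "b \<in> interval x z" "d x b = r" "d a b = r"
    using metric_triangle_sub[OF t a(1)] a(2) by metis
  obtain c where c: "c \<in> interval y z" "d y c = r" "d a2 c = r"
    using metric_triangle_sub[OF metric_triangle_swap[OF ty] a2y] a2(2) by metis
  have bz: "b \<in> interval z x" and cz: "c \<in> interval z y" using b(1) c(1) interval_sym by blast+
  have bV: "b \<in> V" and cV: "c \<in> V" using b(1) c(1) interval_in by blast+
  have zb: "d z b = r + l" and zc: "d z c = r + l"
    using interval_d[OF b(1)] interval_d[OF c(1)] b(2) c(2) xz yz d_sym[of b z] d_sym[of c z]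
    by linarith+
  have bc: "d b c \<le> 2 * r + l"
    using d_triangle[OF bV aV cV] d_triangle[OF aV a2V cV] a2(3) b(3) c(3) d_sym[of b a] d_sym[of a a2]
    by linarith
  obtain z' b' c' where g: "pre_quasi_median z b c z' b' c'" and t': "metric_triangle z' b' c'"
    using quasi_median_exists[OF V(3) bV cV] by blast
  note i = pre_quasi_median_intervals[OF V(3) bV cV g]
  have "z' \<in> interval z x" "z' \<in> interval z y"
    using interval_trans[OF V(3,1) bz i(1)] interval_trans[OF V(3,2) cz i(2)] .
  then have z': "z' = z" using t by (auto simp: metric_triangle_def)
  have V': "b' \<in> V" "c' \<in> V" using i interval_in by blast+
  have "d z b = d z b' + d b' b" "d z c = d z c' + d c' c" "d b c = d b b' + d b' c' + d c' c"
    using g V(3) unfolding pre_quasi_median_def z' by simp_all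
  \<comment> \<open>With \<open>e = d z b'\<close> the quasi-median gives
    \<open>d b c = 2 * (r + l - e) + e\<close>, while the route through \<open>a\<close> and
    \<open>a2\<close> bounds \<open>d b c\<close> by \<open>2 * r + l\<close>. So \<open>e\<close>
    is at least \<open>l\<close>, hence at least \<open>r\<close>.\<close>
  then have "r \<le> d z b'"
    using metric_triangle_equilateral[OF t'] bc zb zc l(2) d_sym[of b b'] unfolding z' by linarith
  from interval_point[OF V(3) V'(1) this]
  obtain b2 where b2: "b2 \<in> interval z b'" "d z b2 = r" by blast
  obtain c2 where c2: "c2 \<in> interval z c'" "d z c2 = r" "d b2 c2 = r"
    using metric_triangle_sub[OF t'[unfolded z'] b2(1)] b2(2) by metis
  have b2b: "b2 \<in> interval z b" using interval_trans[OF V(3) bV i(3) b2(1)] .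
  have c2c: "c2 \<in> interval z c" using interval_trans[OF V(3) cV i(5) c2(1)] .
  have b2z: "b2 \<in> interval z x" and c2z: "c2 \<in> interval y z"
    using interval_trans[OF V(3,1) bz b2b] interval_trans[OF V(3,2) cz c2c] interval_sym by blast+
  have b2V: "b2 \<in> V" and c2V: "c2 \<in> V" using b2b c2c interval_in by blast+
  have sides: "d a a2 = l" "d a2 c = r" "d c c2 = l" "d c2 b2 = r" "d b2 b = l" "d b a = r"
    using a2(3) b(3) c(3) b2(2) c2(2,3) interval_d[OF b2b] interval_d[OF c2c] zb zc
      d_sym[of a a2] d_sym[of c c2] d_sym[of c2 b2] d_sym[of b a] by linarith+
  \<comment> \<open>At each turn one end of the two consecutive sides is at distance
    \<open>r\<close> from a corner of the triangle, and the other end is on the side opposite that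
    corner, at distance \<open>2 * r + l\<close> from it. So the ends are at least
    \<open>r + l\<close> apart.\<close>
  have "d a c = d a a2 + d a2 c"
    using d_triangle[OF V(1) aV cV] d_triangle[OF aV a2V cV] x_opp[OF c(1)] a(2) sides
    by linarith
  moreover have "d a2 c2 = d a2 c + d c c2"
    using d_triangle[OF V(3) c2V a2V] d_triangle[OF a2V cV c2V] z_opp[of a2] a2y c2(2) sides
      d_sym[of c2 a2] interval_sym[of x y] by auto
  moreover have "d c b2 = d c c2 + d c2 b2"
    using d_triangle[OF V(2) cV b2V] d_triangle[OF cV c2V b2V] y_opp[OF b2z] c(2) sides
    by linarith
  moreover have "d c2 b = d c2 b2 + d b2 b"
    using d_triangle[OF V(1) bV c2V] d_triangle[OF c2V b2V bV] x_opp[OF c2z] b(2) sides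
      d_sym[of b c2] by linarith
  moreover have "d b2 a = d b2 b + d b a"
    using d_triangle[OF V(3) b2V aV] d_triangle[OF b2V bV aV] z_opp[OF a(1)] b2(2) sides
    by linarith
  moreover have "d b a2 = d b a + d a a2"
    using d_triangle[OF V(2) a2V bV] d_triangle[OF bV aV a2V] y_opp[OF bz] a2(2) sides
      d_sym[of b a2] by linarith
  ultimately show False
    using no_hexagon[OF aV a2V cV c2V b2V bV] sides l(2) unfolding r_def by simp
qed

text \<open>For distant \<open>x\<close> and \<open>y\<close>, the quasi-medians with
  \<open>u\<close> and with \<open>v\<close> give two geodesics between them, leaving
  \<open>x\<close> and \<open>y\<close> towards \<open>u\<close> and towards \<open>v\<close>
  respectively. As both vertices lie in \<open>interval u v\<close>, the turns there are straight,
  and a forbidden hexagon arises.\<close>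

lemma thin_intervals:
  assumes V: "u \<in> V" "v \<in> V" and x: "x \<in> interval u v" and y: "y \<in> interval u v"
    and eq: "d u x = d u y"
  shows "d x y < 10 * s"
proof (rule ccontr)
  define r where "r = 2 * s"
  assume "\<not> ?thesis"
  then have far: "5 * r \<le> d x y" by (simp add: r_def)
  have xyV: "x \<in> V" "y \<in> V" using x y interval_in by blast+
  have branch: "\<exists>a b. a \<in> interval x o' \<and> b \<in> interval y o' \<and> d x a = r \<and> d y b = r \<and>
      d x y = r + d a b + r"
    if oV: "o' \<in> V" and oeq: "d o' x = d o' y" for o'
  proof -
    obtain o2 x' y' where g: "pre_quasi_median o' x y o2 x' y'" and t: "metric_triangle o2 x' y'"
      using quasi_median_exists[OF oV xyV] by blast
    note i = pre_quasi_median_intervals[OF oV xyV g]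
    have V': "x' \<in> V" "y' \<in> V" using i interval_in by blast+
    have sz: "d o2 x' < 3 * r" using metric_triangle_small[OF t] by (simp add: r_def)
    have "d x x' = d y y'" "d x y = 2 * d x x' + d o2 x'"
      using g metric_triangle_equilateral[OF t] oeq d_sym[of x x'] d_sym[of y y']
      by (auto simp: pre_quasi_median_def)
    \<comment> \<open>Of \<open>5 * r\<close>, a triangle side takes less than \<open>3 * r\<close>,
      and the two equal legs share the rest.\<close>
    then have le: "r \<le> d x x'" "r \<le> d y y'" using far sz by auto
    obtain a where a: "a \<in> interval x x'" "d x a = r" "d a x' = d x x' - r"
      using interval_point[OF xyV(1) V'(1) le(1)] by blast
    obtain b where b: "b \<in> interval y y'" "d y b = r" "d b y' = d y y' - r"
      using interval_point[OF xyV(2) V'(2) le(2)] by blast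
    have abV: "a \<in> V" "b \<in> V" using a b interval_in by blast+
    have "d x y = d x x' + d x' y' + d y y'"
      using g d_sym[of y y'] by (simp add: pre_quasi_median_def)
    then have "d x y = r + d a b + r"
      using d_triangle[of x a y] d_triangle[of a b y] d_triangle[of a x' b] d_triangle[of x' y' b]
        abV xyV V' a b le d_sym[of b y] d_sym[of b y'] by auto
    moreover have "a \<in> interval x o'"
      using interval_trans[OF xyV(1) oV _ a(1)] i(3) interval_sym by blast
    moreover have "b \<in> interval y o'"
      using interval_trans[OF xyV(2) oV _ b(1)] i(5) interval_sym by blast
    ultimately show ?thesis using a b by blast
  qed
  obtain a b where ab: "a \<in> interval x u" "b \<in> interval y u" "d x a = r" "d y b = r"
      "d x y = r + d a b + r" using branch[OF V(1) eq] by blast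
  have "d v x = d v y" using interval_d[OF x] interval_d[OF y] eq d_sym[of v x] d_sym[of v y] by simp
  then obtain a' b' where ab': "a' \<in> interval x v" "b' \<in> interval y v" "d x a' = r" "d y b' = r"
      "d x y = r + d a' b' + r" using branch[OF V(2)] by blast
  have VV: "a \<in> V" "b \<in> V" "a' \<in> V" "b' \<in> V" using ab ab' interval_in by blast+
  have syms: "d a x = d x a" "d a' x = d x a'" "d b y = d y b" "d b' y = d y b'" "d b' a' = d a' b'"
    "d u a = d a u" "d u b = d b u" "d u x = d x u" "d u y = d y u"
    using d_sym by blast+
  have turn: "d p p' = 2 * r" if "q \<in> interval u v" "p \<in> interval q u" "p' \<in> interval q v"
    "d q p = r" "d q p' = r" for q p p'
  proof -
    have qV: "q \<in> V" "p \<in> V" "p' \<in> V" using that interval_in by blast+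
    then show ?thesis
      using d_triangle[of u p v] d_triangle[of p p' v] d_triangle[of p q p'] V
        interval_d[OF that(1)] interval_d[OF that(2)] interval_d[OF that(3)] that(4,5)
        d_sym[of u p] d_sym[of u q] d_sym[of p q] by auto
  qed
  have "d x b = d x a + d a b" "d a y = d a b + d b y"
    using ab syms d_triangle[of x a b] d_triangle[of x b y] d_triangle[of a b y] d_triangle[of x a y]
      VV xyV by auto
  moreover have "d b b' = d b y + d y b'" "d a' a = d a' x + d x a"
    using turn[OF y ab(2) ab'(2)] turn[OF x ab(1) ab'(1)] ab ab' syms d_sym[of a' a] by auto
  moreover have "d y a' = d y b' + d b' a'" "d b' x = d b' a' + d a' x"
    using ab' syms d_triangle[of x a' b'] d_triangle[of x b' y] d_triangle[of a' b' y]
      d_triangle[of x a' y] d_sym[of y a'] d_sym[of b' x] VV xyV by auto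
  ultimately show False
    using no_hexagon[of x a b y b' a'] VV xyV ab ab' syms far unfolding r_def by auto
qed

text \<open>Here \<open>t\<close> is at most the Gromov product of \<open>x\<close> and
  \<open>y\<close> at \<open>w\<close>. Some geodesics through the quasi-median have their vertices
  at level \<open>t\<close> within \<open>6 * s\<close> of each other, and thinness of the two
  intervals adds \<open>10 * s\<close> on each side.\<close>

lemma fellow_travel:
  assumes V: "w \<in> V" "x \<in> V" "y \<in> V"
    and px: "p \<in> interval w x" "d w p = t" and qy: "q \<in> interval w y" "d w q = t"
    and t: "2 * t + d x y \<le> d w x + d w y"
  shows "d p q \<le> 26 * s"
proof -
  obtain w' x' y' where g: "pre_quasi_median w x y w' x' y'" and m: "metric_triangle w' x' y'"
    using quasi_median_exists[OF V] by blast
  note i = pre_quasi_median_intervals[OF V g]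
  have V': "w' \<in> V" "x' \<in> V" "y' \<in> V" "p \<in> V" "q \<in> V" using i px qy interval_in by blast+
  have sz: "d w' x' < 6 * s" using metric_triangle_small[OF m] .
  have t': "2 * t \<le> 2 * d w w' + d w' x'"
    using g t metric_triangle_equilateral[OF m] d_sym[of x x'] by (auto simp: pre_quasi_median_def)
  have "\<exists>a b. a \<in> interval w x \<and> b \<in> interval w y \<and> d w a = t \<and> d w b = t \<and> d a b \<le> 6 * s"
  proof (cases "t \<le> d w w'")
    case True
    obtain a where a: "a \<in> interval w w'" "d w a = t"
      using interval_point[OF V(1) V'(1) True] by blast
    then have "a \<in> interval w x" "a \<in> interval w y" "d a a = 0"
      using interval_trans[OF V(1,2) i(1)] interval_trans[OF V(1,3) i(2)] interval_in by auto
    then show ?thesis using a by (intro exI[of _ a]) simp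
  next
    case False
    define e where "e = t - d w w'"
    have e: "t = d w w' + e" "2 * e \<le> d w' x'" using False t' by (auto simp: e_def)
    have weq: "d w' y' = d w' x'" using metric_triangle_equilateral[OF m] by simp
    have "e \<le> d w' x'" "e \<le> d w' y'" using e weq by auto
    then obtain a b where a: "a \<in> interval w' x'" "d w' a = e"
      and b: "b \<in> interval w' y'" "d w' b = e"
      using interval_point[OF V'(1,2)] interval_point[OF V'(1,3)] by metis
    have abV: "a \<in> V" "b \<in> V" using a b interval_in by blast+
    have wa: "d w a = t \<and> a \<in> interval w x"
      using g a e(1) d_triangle[of w w' a] d_triangle[of w a x] d_triangle[of a x' x] abV V V'
      by (auto simp: pre_quasi_median_def interval_def)
    have wb: "d w b = t \<and> b \<in> interval w y"
      using g b e(1) d_triangle[of w w' b] d_triangle[of w b y] d_triangle[of b y' y] abV V V'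
      by (auto simp: pre_quasi_median_def interval_def)
    \<comment> \<open>The path through \<open>w'\<close> suffices: its length \<open>2 * e\<close>
      is at most the triangle side.\<close>
    have "d a b \<le> 6 * s"
      using d_triangle[of a w' b] abV V' a b e sz d_sym[of a w'] by auto
    with wa wb show ?thesis by blast
  qed
  then obtain a b where ab: "a \<in> interval w x" "b \<in> interval w y" "d w a = t" "d w b = t"
    "d a b \<le> 6 * s" by blast
  have abV: "a \<in> V" "b \<in> V" using ab interval_in by blast+
  have "d p a < 10 * s" using thin_intervals[OF V(1,2) px(1) ab(1)] px ab by simp
  moreover have "d b q < 10 * s" using thin_intervals[OF V(1,3) ab(2) qy(1)] qy ab by simp
  ultimately show ?thesis
    using d_triangle[of p a q] d_triangle[of a b q] abV V' ab by auto
qed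

text \<open>Geodesics from \<open>w\<close> to \<open>x\<close> and to \<open>z\<close> both stay
  near one to \<open>y\<close> up to level \<open>t\<close>, the smaller of two Gromov products, so
  a path from \<open>x\<close> to \<open>z\<close> can cross over there at cost
  \<open>52 * s\<close>. The products are rounded down, and the last \<open>s\<close> absorbs the
  lost unit.\<close>

lemma four_point:
  assumes V: "w \<in> V" "x \<in> V" "y \<in> V" "z \<in> V"
  shows "d x z + d w y \<le> max (d x y + d w z) (d y z + d w x) + 53 * s"
proof -
  define t where "t = min ((d w x + d w y - d x y) div 2) ((d w y + d w z - d y z) div 2)"
  have tri: "d x y \<le> d w x + d w y" "d y z \<le> d w y + d w z"
    "d w y \<le> d w x + d x y" "d w x \<le> d w y + d x y" "d w z \<le> d w y + d y z" "d w y \<le> d w z + d y z"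
    using d_triangle[of x w y] d_triangle[of y w z] d_triangle[of w x y] d_triangle[of w y x]
      d_triangle[of w y z] d_triangle[of w z y] V d_sym[of x w] d_sym[of y w] d_sym[of y x]
      d_sym[of z y] by auto
  have t: "2 * t + d x y \<le> d w x + d w y" "2 * t + d y z \<le> d w y + d w z"
    using tri by (auto simp: t_def min_def)
  have t2: "d w x + d w y \<le> 2 * t + 1 + d x y \<or> d w y + d w z \<le> 2 * t + 1 + d y z"
    by (auto simp: t_def min_def)
  have le: "t \<le> d w x" "t \<le> d w y" "t \<le> d w z" using t tri by auto
  obtain p where p: "p \<in> interval w x" "d w p = t" "d p x = d w x - t"
    using interval_point[OF V(1,2) le(1)] by blast
  obtain q where q: "q \<in> interval w y" "d w q = t"
    using interval_point[OF V(1,3) le(2)] by blast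
  obtain r where r: "r \<in> interval w z" "d w r = t" "d r z = d w z - t"
    using interval_point[OF V(1,4) le(3)] by blast
  have VV: "p \<in> V" "q \<in> V" "r \<in> V" using p q r interval_in by blast+
  have "d p q \<le> 26 * s" using fellow_travel[OF V(1,2,3) p(1,2) q t(1)] .
  moreover have "d q r \<le> 26 * s" using fellow_travel[OF V(1,3,4) q r(1,2) t(2)] .
  ultimately have "d x z \<le> (d w x - t) + 52 * s + (d w z - t)"
    using d_triangle[of x p z] d_triangle[of p r z] d_triangle[of p q r] V VV p r d_sym[of x p] by auto
  then show ?thesis using t2 le s_pos by (auto simp: max_def)
qed

end

section \<open>The distance in a connected graph\<close>

text \<open>A natural-valued form of \<open>gdist\<close> for connected graphs, which keeps the
  metric arguments within \<open>nat\<close>.\<close>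

definition hop_dist :: "('a, 'b) pre_digraph \<Rightarrow> 'a \<Rightarrow> 'a \<Rightarrow> nat" where
  "hop_dist G u v = (LEAST n. \<exists>p. pre_digraph.awalk G u p v \<and> length p = n)"

context connected_simple_graph
begin

lemma hop_dist_le: "awalk u p v \<Longrightarrow> hop_dist G u v \<le> length p"
  unfolding hop_dist_def by (rule Least_le) blast

lemma awalk_reverse: "awalk u p v \<Longrightarrow> \<exists>q. awalk v q u \<and> length q = length p"
proof (induction p arbitrary: u)
  case Nil
  then show ?case by (intro exI[of _ "[]"]) (auto simp: awalk_Nil_iff)
next
  case (Cons e p)
  then have e: "e \<in> arcs G" "u = tail G e" "awalk (head G e) p v"
    by (auto simp: awalk_Cons_iff)
  obtain q where q: "awalk v q (head G e)" "length q = length p" using Cons.IH[OF e(3)] by blast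
  have "head G e \<rightarrow> u" using graph_symmetric in_arcs_imp_in_arcs_ends[OF e(1)] e(2) by simp
  then obtain f where f: "f \<in> arcs G" "tail G f = head G e" "head G f = u"
    by (auto simp: arcs_ends_conv)
  then have "awalk (head G e) [f] u" by (auto simp: awalk_Cons_iff awalk_Nil_iff)
  then have "awalk v (q @ [f]) u" using q(1) by (rule awalk_appendI[rotated])
  then show ?case using q(2) by (intro exI[of _ "q @ [f]"]) simp
qed

text \<open>Reversal preserves lengths, so both minima range over the same set, even an empty one;
  \<open>d_sym\<close> asks for symmetry on the whole type.\<close>

lemma hop_dist_sym: "hop_dist G u v = hop_dist G v u"
proof -
  have "(\<lambda>n. \<exists>p. awalk u p v \<and> length p = n) = (\<lambda>n. \<exists>p. awalk v p u \<and> length p = n)"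
    using awalk_reverse[of u _ v] awalk_reverse[of v _ u] by (intro ext) fastforce
  then show ?thesis by (simp add: hop_dist_def)
qed

lemma shortest_awalk:
  assumes "u \<in> verts G" "v \<in> verts G"
  obtains p where "awalk u p v" "length p = hop_dist G u v"
proof -
  have "u \<rightarrow>\<^sup>* v"
    using connected_G assms reachable_mk_symmetric_eq[OF sym_arcs]
    by (auto simp: Digraph_Component.connected_def strongly_connected_def)
  then obtain p where "awalk u p v" by (auto simp: reachable_awalk)
  then have "\<exists>p. awalk u p v \<and> length p = hop_dist G u v"
    unfolding hop_dist_def using LeastI_ex[of "\<lambda>n. \<exists>p. awalk u p v \<and> length p = n"] by blast
  then show ?thesis using that by blast
qed

lemma gdist_eq_hop_dist:
  assumes "u \<in> verts G" "v \<in> verts G"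
  shows "gdist G u v = ereal (real (hop_dist G u v))"
proof (rule antisym)
  obtain p where "awalk u p v" "length p = hop_dist G u v" using shortest_awalk[OF assms] .
  then show "gdist G u v \<le> ereal (real (hop_dist G u v))"
    unfolding gdist_le_iff[OF wf_digraph_axioms] by auto
next
  have "awalk_cost (\<lambda>_. 1) p = real (length p)" for p by (induction p) auto
  then show "ereal (real (hop_dist G u v)) \<le> gdist G u v"
    unfolding gdist_def \<mu>_def by (intro INF_greatest) (auto dest: hop_dist_le)
qed

lemma hop_dist_1_dominates:
  assumes "u \<in> verts G" "v \<in> verts G" "hop_dist G u v = 1"
  shows "u \<rightarrow> v"
proof -
  obtain p where p: "awalk u p v" "length p = hop_dist G u v" using shortest_awalk[OF assms(1,2)] .
  then obtain e where "p = [e]" using assms(3) by (auto simp: length_Suc_conv)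
  with p show ?thesis
    by (auto simp: awalk_Cons_iff awalk_Nil_iff dest: in_arcs_imp_in_arcs_ends)
qed

lemma hop_dist_dominates:
  assumes "u \<rightarrow> v"
  shows "hop_dist G u v = 1"
proof -
  obtain e where e: "e \<in> arcs G" "tail G e = u" "head G e = v"
    using assms by (auto simp: arcs_ends_conv)
  then have V: "u \<in> verts G" "v \<in> verts G" "u \<noteq> v" using no_loops[OF e(1)] by auto
  have "awalk u [e] v" using e V by (auto simp: awalk_Cons_iff awalk_Nil_iff)
  from hop_dist_le[OF this] have "hop_dist G u v \<le> 1" by simp
  moreover have "hop_dist G u v \<noteq> 0"
  proof
    assume "hop_dist G u v = 0"
    moreover obtain p where "awalk u p v" "length p = hop_dist G u v"
      using shortest_awalk[OF V(1,2)] .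
    ultimately show False using V(3) by (simp add: awalk_Nil_iff)
  qed
  ultimately show ?thesis by simp
qed

sublocale hop: geodesic_metric "verts G" "hop_dist G"
proof
  show "hop_dist G x y = 0 \<longleftrightarrow> x = y" if V: "x \<in> verts G" "y \<in> verts G" for x y
  proof
    assume "hop_dist G x y = 0"
    moreover obtain p where "awalk x p y" "length p = hop_dist G x y"
      using shortest_awalk[OF V] .
    ultimately show "x = y" by (simp add: awalk_Nil_iff)
  next
    assume "x = y"
    then have "awalk x [] y" using V by (simp add: awalk_Nil_iff)
    from hop_dist_le[OF this] show "hop_dist G x y = 0" by simp
  qed
  show tri: "hop_dist G x z \<le> hop_dist G x y + hop_dist G y z"
    if V: "x \<in> verts G" "y \<in> verts G" "z \<in> verts G" for x y z
  proof -
    obtain p where p: "awalk x p y" "length p = hop_dist G x y" using shortest_awalk[OF V(1,2)] .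
    obtain q where q: "awalk y q z" "length q = hop_dist G y z" using shortest_awalk[OF V(2,3)] .
    show ?thesis using hop_dist_le[OF awalk_appendI[OF p(1) q(1)]] p q by simp
  qed
  show "\<exists>z\<in>verts G. hop_dist G x z = i \<and> hop_dist G z y = hop_dist G x y - i"
    if V: "x \<in> verts G" "y \<in> verts G" and i: "i \<le> hop_dist G x y" for x y i
  proof -
    obtain p where p: "awalk x p y" "length p = hop_dist G x y" using shortest_awalk[OF V] .
    \<comment> \<open>By the triangle inequality, both parts of a shortest walk split after
      \<open>i\<close> arcs are shortest.\<close>
    then have "awalk x (take i p @ drop i p) y" by simp
    then obtain z where z: "awalk x (take i p) z" "awalk z (drop i p) y"
      unfolding awalk_append_iff by blast
    then have "z \<in> verts G" by auto
    then show ?thesis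
      using hop_dist_le[OF z(1)] hop_dist_le[OF z(2)] tri[OF V(1) _ V(2), of z] p(2) i
      by (intro bexI[of _ z]) auto
  qed
qed (rule hop_dist_sym)

text \<open>The ball in the dismantling condition is taken after deleting \<open>u\<close>, so a
  geodesic avoiding \<open>u\<close> must be turned into a walk of the smaller graph.\<close>

lemma awalk_del_vert:
  assumes "\<And>i. i < n \<Longrightarrow> f i \<rightarrow> f (Suc i)" "\<And>i. i \<le> n \<Longrightarrow> f i \<in> verts G - {u}"
  shows "\<exists>p. pre_digraph.awalk (del_vert u) (f 0) p (f n) \<and> length p = n"
  using assms
proof (induction n)
  case 0
  interpret D: wf_digraph "del_vert u" by (rule wf_digraph_del_vert)
  from 0 have "D.awalk (f 0) [] (f 0)" by (auto simp: D.awalk_Nil_iff verts_del_vert)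
  then show ?case by blast
next
  case (Suc n)
  interpret D: wf_digraph "del_vert u" by (rule wf_digraph_del_vert)
  obtain p where p: "D.awalk (f 0) p (f n)" "length p = n" using Suc by auto
  obtain e where e: "e \<in> arcs G" "tail G e = f n" "head G e = f (Suc n)"
    using Suc.prems(1)[of n] by (auto simp: arcs_ends_conv)
  then have "D.awalk (f n) [e] (f (Suc n))"
    using Suc.prems(2)[of n] Suc.prems(2)[of "Suc n"]
    by (auto simp: D.awalk_Cons_iff D.awalk_Nil_iff del_vert_simps)
  then have "D.awalk (f 0) (p @ [e]) (f (Suc n))" by (rule D.awalk_appendI[OF p(1)])
  then show ?case using p(2) by (intro exI[of _ "p @ [e]"]) simp
qed

section \<open>Last vertices in a dismantling order\<close>

lemma finite_subset_has_last:
  assumes R: "well_order_on (verts G) R" and "finite H" "H \<noteq> {}" "H \<subseteq> verts G"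
  shows "\<exists>v\<in>H. \<forall>w\<in>H. (w, v) \<in> R"
proof -
  have R': "refl_on (verts G) R" "trans R" "total_on (verts G) R"
    using R by (auto simp: order_on_defs well_order_on_def)
  show ?thesis
    using assms(2-4)
  proof (induction H rule: finite_ne_induct)
    case (singleton x)
    then show ?case using R'(1) by (auto simp: refl_on_def)
  next
    case (insert x F)
    then obtain v where v: "v \<in> F" "\<forall>w\<in>F. (w, v) \<in> R" by auto
    have "(x, v) \<in> R \<or> (v, x) \<in> R"
      using R'(1,3) insert.prems v(1) by (cases "x = v") (auto simp: total_on_def refl_on_def)
    then show ?case
    proof
      assume "(x, v) \<in> R"
      then show ?thesis using v by auto
    next
      assume "(v, x) \<in> R"
      then have "\<forall>w\<in>F. (w, x) \<in> R" using v R'(2) by (meson transD)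
      moreover have "(x, x) \<in> R" using R'(1) insert.prems by (auto simp: refl_on_def)
      ultimately show ?thesis by auto
    qed
  qed
qed

text \<open>
  The last vertex \<open>v\<close> of \<open>H\<close> has both ends of a geodesic of length \<open>2 * s\<close> among its
  predecessors; a vertex \<open>u\<close> off this geodesic cannot be within \<open>s - 1\<close> of both ends, and a vertex
  on it is at distance more than \<open>s\<close> from the end on the far side of \<open>v\<close>.
\<close>

lemma dismantlable_no_midpoints:
  assumes dis: "dismantlable s s' G" and less: "s' < s"
    and H: "finite H" "H \<noteq> {}" "H \<subseteq> verts G"
  shows "\<exists>v\<in>H. \<not> hop.midpoint_in s H v"
proof (rule ccontr)
  assume "\<not> ?thesis"
  then have mid: "hop.midpoint_in s H v" if "v \<in> H" for v using that by blast
  obtain R where R: "well_order_on (verts G) R" and dom: "\<And>v. v \<in> verts G \<Longrightarrow>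
      \<not> (\<forall>w\<in>verts G. (v, w) \<in> R) \<Longrightarrow> \<exists>u\<in>verts G. u \<noteq> v \<and> (u, v) \<in> R \<and>
        gball s v (del_vert u) \<inter> {w. (w, v) \<in> R} \<subseteq> gball s' u G"
    using dis unfolding dismantlable_def by blast
  obtain v where v: "v \<in> H" "\<And>w. w \<in> H \<Longrightarrow> (w, v) \<in> R"
    using finite_subset_has_last[OF R H] by blast
  obtain g where g: "g s = v" "\<And>i. i \<le> 2 * s \<Longrightarrow> g i \<in> H"
    "\<And>i j. j \<le> 2 * s \<Longrightarrow> i \<le> j \<Longrightarrow> hop_dist G (g i) (g j) = j - i"
    using mid[OF v(1)] unfolding hop.midpoint_in_def by blast
  have gV: "g i \<in> verts G" if "i \<le> 2 * s" for i using g(2)[OF that] H(3) by blast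
  have vV: "v \<in> verts G" using v(1) H(3) by blast
  \<comment> \<open>The vertex \<open>g 0\<close> strictly precedes \<open>v\<close>, so
    \<open>v\<close> is not the least vertex and has a dominating \<open>u\<close>.\<close>
  have "g 0 \<noteq> v" using g(3)[of s 0] g(1) less hop.d_self[OF vV] by auto
  moreover have "(g 0, v) \<in> R" using g(2) v(2) by simp
  moreover have "antisym R" using R by (auto simp: order_on_defs well_order_on_def)
  ultimately have "\<not> (\<forall>w\<in>verts G. (v, w) \<in> R)" using gV[of 0] by (auto dest: antisymD)
  then obtain u where u: "u \<in> verts G" "u \<noteq> v"
    "gball s v (del_vert u) \<inter> {w. (w, v) \<in> R} \<subseteq> gball s' u G"
    using dom[OF vV] by blast
  \<comment> \<open>A half of the geodesic that starts at \<open>v\<close> and avoids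
    \<open>u\<close> survives the deletion of \<open>u\<close>, so its end lies in the ball of
    radius \<open>s\<close> and is dominated by \<open>u\<close>.\<close>
  have near: "hop_dist G u (f s) \<le> s'"
    if f: "f 0 = v" "\<And>i. i \<le> s \<Longrightarrow> f i \<in> H - {u}" "\<And>i. i < s \<Longrightarrow> hop_dist G (f i) (f (Suc i)) = 1"
    for f
  proof -
    have fV: "f i \<in> verts G - {u}" if "i \<le> s" for i using f(2)[OF that] H(3) by blast
    have "\<exists>p. pre_digraph.awalk (del_vert u) (f 0) p (f s) \<and> length p = s"
      using awalk_del_vert[of s f u] fV hop_dist_1_dominates f(3) by auto
    then have "gdist (del_vert u) v (f s) \<le> ereal (real s)"
      unfolding gdist_le_iff[OF wf_digraph_del_vert] using f(1) by auto
    then have "f s \<in> gball s v (del_vert u)"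
      using fV[of s] by (auto simp: gball_def verts_del_vert)
    moreover have "(f s, v) \<in> R" using f(2)[of s] v(2) by simp
    ultimately have "f s \<in> gball s' u G" using u(3) by blast
    then show ?thesis using gdist_eq_hop_dist[OF u(1)] fV[of s] by (auto simp: gball_def)
  qed
  have right: "hop_dist G u (g (2 * s)) \<le> s'" if "\<And>i. s < i \<Longrightarrow> i \<le> 2 * s \<Longrightarrow> g i \<noteq> u"
  proof -
    have "g (s + i) \<noteq> u" if "i \<le> s" for i
      using \<open>\<And>i. s < i \<Longrightarrow> i \<le> 2 * s \<Longrightarrow> g i \<noteq> u\<close>[of "s + i"] u(2) g(1) that by (cases "i = 0") auto
    then show ?thesis
      using near[of "\<lambda>i. g (s + i)"] g by (simp add: mult_2)
  qed
  have left: "hop_dist G u (g 0) \<le> s'" if "\<And>i. i < s \<Longrightarrow> g i \<noteq> u"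
  proof -
    \<comment> \<open>For \<open>i > s\<close> the truncated difference is 0, which is still an
      index below \<open>s\<close>.\<close>
    have "g (s - i) \<noteq> u" for i using that[of "s - i"] u(2) g(1) less by (cases "i = 0") auto
    moreover have "hop_dist G (g (s - i)) (g (s - Suc i)) = 1" if "i < s" for i
      using g(3)[of "s - i" "s - Suc i"] that hop_dist_sym[of "g (s - i)"] by simp
    ultimately show ?thesis
      using near[of "\<lambda>i. g (s - i)"] g by simp
  qed
  have far: "hop_dist G (g 0) (g (2 * s)) = 2 * s" using g(3)[of "2 * s" 0] by simp
  show False
  proof (cases "\<exists>k \<le> 2 * s. g k = u")
    case True
    then obtain k where k: "k \<le> 2 * s" "g k = u" by blast
    have inj: "g i \<noteq> u" if "i \<le> 2 * s" "i \<noteq> k" for i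
      using g(3)[of i k] g(3)[of k i] that k u(1) hop.d_self[OF u(1)] by (cases "i \<le> k") force+
    have "k \<noteq> s" using k u(2) g(1) by auto
    then consider "k < s" | "s < k" by linarith
    then show False
    proof cases
      case 1
      then have "hop_dist G u (g (2 * s)) \<le> s'" using right inj by auto
      then show False using g(3)[of "2 * s" k] k 1 less by simp
    next
      case 2
      then have "hop_dist G u (g 0) \<le> s'" using left inj by auto
      then show False using g(3)[of k 0] k 2 less hop_dist_sym[of "g 0" u] by simp
    qed
  next
    case False
    then have "hop_dist G u (g (2 * s)) \<le> s'" "hop_dist G u (g 0) \<le> s'" using right left by auto
    then show False
      using hop.d_triangle[OF gV[of 0] u(1) gV[of "2 * s"]] far less hop_dist_sym[of "g 0" u] by simp
  qed
qed

section \<open>Weak modularity for the hop distance\<close>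

lemma weakly_modular_hop_dist:
  assumes "weakly_modular G"
  shows "weakly_modular_metric (verts G) (hop_dist G)"
proof unfold_locales
  fix u v w
  assume V: "u \<in> verts G" "v \<in> verts G" "w \<in> verts G"
    and h: "hop_dist G v w = 1" "hop_dist G u v = hop_dist G u w"
  have "hop_dist G u v \<noteq> 0"
    using h V hop.d_eq_0[of u v] hop.d_eq_0[of u w] hop.d_self[of u] by auto
  then consider "hop_dist G u v = 1" | "1 < hop_dist G u v" by linarith
  then show "\<exists>x\<in>verts G. hop_dist G v x = 1 \<and> hop_dist G w x = 1 \<and> hop_dist G u x + 1 = hop_dist G u v"
  proof cases
    case 1
    then show ?thesis
      using V h hop_dist_sym[of v u] hop_dist_sym[of w u] by (intro bexI[of _ u]) auto
  next
    case 2
    have "\<exists>x\<in>verts G. x \<rightarrow> v \<and> x \<rightarrow> w \<and> gdist G u x = gdist G u v - 1"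
      using assms V h 2 unfolding weakly_modular_def triangle_condition_def
      by (auto simp: gdist_eq_hop_dist)
    then obtain x where x: "x \<in> verts G" "x \<rightarrow> v" "x \<rightarrow> w" "gdist G u x = gdist G u v - 1" by blast
    then have "hop_dist G u x + 1 = hop_dist G u v"
      using V 2 by (auto simp: gdist_eq_hop_dist one_ereal_def)
    then show ?thesis using x hop_dist_dominates graph_symmetric by blast
  qed
next
  fix u v w z
  assume V: "u \<in> verts G" "v \<in> verts G" "w \<in> verts G" "z \<in> verts G"
    and h: "hop_dist G v z = 1" "hop_dist G w z = 1" "hop_dist G v w = 2"
      "hop_dist G u v = hop_dist G u w" "hop_dist G u z = hop_dist G u v + 1"
  have "hop_dist G u v \<noteq> 0"
    using h V hop.d_eq_0[of u v] hop.d_eq_0[of u w] hop.d_self[of u] by auto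
  then consider "hop_dist G u v = 1" | "2 \<le> hop_dist G u v" by linarith
  then show "\<exists>x\<in>verts G. hop_dist G v x = 1 \<and> hop_dist G w x = 1 \<and> hop_dist G u x + 1 = hop_dist G u v"
  proof cases
    case 1
    then show ?thesis
      using V h hop_dist_sym[of v u] hop_dist_sym[of w u] by (intro bexI[of _ u]) auto
  next
    case 2
    have "gdist G v z = 1" "gdist G w z = 1" "gdist G v w = 2" "2 \<le> gdist G u v"
      "gdist G u v = gdist G u w" "gdist G u w = gdist G u z - 1"
      using V h 2 by (auto simp: gdist_eq_hop_dist one_ereal_def)
    then have "\<exists>x\<in>verts G. x \<rightarrow> v \<and> x \<rightarrow> w \<and> gdist G u x = gdist G u v - 1"
      using assms V unfolding weakly_modular_def quadrangle_condition_def by blast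
    then obtain x where x: "x \<in> verts G" "x \<rightarrow> v" "x \<rightarrow> w" "gdist G u x = gdist G u v - 1" by blast
    then have "hop_dist G u x + 1 = hop_dist G u v"
      using V 2 by (auto simp: gdist_eq_hop_dist one_ereal_def)
    then show ?thesis using x hop_dist_dominates graph_symmetric by blast
  qed
qed

end

text \<open>Whichever number is largest, its hypothesis bounds it by the maximum of the other two,
  which is entry 1 of the sorted list.\<close>

lemma sorted_gap_le:
  fixes a b c :: nat
  assumes "a \<le> max b c + n" "b \<le> max a c + n" "c \<le> max a b + n" "real n \<le> e"
  shows "(let ds = sort [ereal a, ereal b, ereal c] in ds ! 2 - ds ! 1 \<le> ereal e)"
  using assms by (auto simp: Let_def max_def numeral_2_eq_2 split: if_splits)

theorem theorem4:
  fixes G :: "('a, 'b) pre_digraph" and s s' :: nat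
  assumes "connected_simple_graph G"
    and "s' < s"
    and "weakly_modular G"
    and "dismantlable s s' G"
  shows "hyperbolic (184 * real s) G"
proof -
  interpret connected_simple_graph G by fact
  interpret M: weakly_modular_metric "verts G" "hop_dist G"
    by (rule weakly_modular_hop_dist) fact
  interpret M: thin_metric "verts G" "hop_dist G" s
    using assms(2) dismantlable_no_midpoints[OF assms(4,2)] by unfold_locales auto
  show ?thesis
    unfolding hyperbolic_def
  proof (intro ballI)
    fix u v x y
    assume V: "u \<in> verts G" "v \<in> verts G" "x \<in> verts G" "y \<in> verts G"
    let ?d = "hop_dist G"
    let ?a = "?d u v + ?d x y" and ?b = "?d u x + ?d v y" and ?c = "?d u y + ?d v x"
    have syms: "?d y x = ?d x y" "?d x v = ?d v x" "?d y v = ?d v y" using hop_dist_sym by blast+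
    \<comment> \<open>One use of \<open>four_point\<close> for each sum as the left-hand side,
      always with base point \<open>u\<close>.\<close>
    have "?a \<le> max ?b ?c + 53 * s" "?b \<le> max ?a ?c + 53 * s" "?c \<le> max ?a ?b + 53 * s"
      using M.four_point[of u x v y] M.four_point[of u v x y] M.four_point[of u v y x] V syms
      by (simp_all add: add.commute max.commute)
    \<comment> \<open>The bound \<open>53 * s\<close> is far below
      \<open>2 * (184 * s)\<close>.\<close>
    from sorted_gap_le[OF this, of "2 * (184 * real s)"]
    show "let ds = sort [gdist G u v + gdist G x y, gdist G u x + gdist G v y,
        gdist G u y + gdist G v x] in ds ! 2 - ds ! 1 \<le> ereal (2 * (184 * real s))"
      using V by (simp add: gdist_eq_hop_dist)
  qed
qed

end
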